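(* Let $\mathbb{M}\subset\mathbb{J}$ and $\mathbb{D}$ be three classes of filters, where $\mathbb{J}$ and $\mathbb{D}$ are $\mathbb{F}_1$-composable. Let $(Y,\tau)$ be a convergence space with $\tau=\mathrm{Adh}_{\mathbb{M}}\tau$, and let $(X,\xi)$ be a convergence space with $\xi$ a $P$-diagonal convergence such that $\mathrm{adh}_\xi^{\natural}(\mathbb{M})\subset\mathbb{M}$. Let $f:(X,\xi)\to(Y,\tau)$ be a continuous surjection. Then $f$ is $\mathbb{M}$-perfect with $(\mathbb{J}/\mathbb{D})$-accessible range (that is, $(Y,\tau)$ is $(\mathbb{J}/\mathbb{D})$-accessible) if and only if the inverse relation $f^{-}:(Y,\tau)\rightrightarrows(X,\xi)$ is an $\mathbb{M}$-compactly $(\mathbb{J}/\mathbb{D})$-meshable relation.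
   Context: Filters and classes. For filters, $\mathcal{F}\leq\mathcal{G}$ means $\mathcal{F}\subset\mathcal{G}$. Families $\mathcal{A},\mathcal{B}$ of subsets of a set mesh, $\mathcal{A}\#\mathcal{B}$, if $A\cap B\neq\emptyset$ for all $A\in\mathcal{A}$, $B\in\mathcal{B}$. $\mathcal{A}^{\uparrow}$ is the family of supersets of members of $\mathcal{A}$. A class of filters $\mathbb{D}$ assigns to each set $X$ a collection $\mathbb{D}(X)$ of filters on $X$; by convention every class contains the degenerate filter $2^X$. $\mathbb{F}_1$ is the class of principal filters $\{A\}^{\uparrow}$. $\mathbb{D}$ is $\mathbb{F}_1$-composable if for all sets $X,Y$, every $\mathcal{F}\in\mathbb{D}(X)$ and every $H\subset X\times Y$, the (possibly degenerate) filter generated by $\{HF:F\in\mathcal{F}\}$ is in $\mathbb{D}(Y)$, where $HF=\{y:\exists x\in F,\ (x,y)\in H\}$. Convergence spaces. A convergence $\xi$ on $X$ is a relation between (proper) filters on $X$ and points of $X$, written $x\in\lim_\xi\mathcal{F}$, such that $\mathcal{F}\leq\mathcal{G}$ implies $\lim_\xi\mathcal{F}\subset\lim_\xi\mathcal{G}$; $x\in\lim_\xi\{x\}^{\uparrow}$ for all $x$; and $\lim_\xi(\mathcal{F}\wedge\mathcal{G})=\lim_\xi\mathcal{F}\cap\lim_\xi\mathcal{G}$, where $\mathcal{F}\wedge\mathcal{G}=\mathcal{F}\cap\mathcal{G}$. A map $f:(X,\xi)\to(Y,\tau)$ is continuous if $f(\lim_\xi\mathcal{F})\subset\lim_\tau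 f(\mathcal{F})$ for all $\mathcal{F}$, where $f(\mathcal{F})$ is the filter generated by $\{f(F):F\in\mathcal{F}\}$. $\mathrm{adh}_\xi\mathcal{F}=\bigcup_{\mathcal{G}\#\mathcal{F}}\lim_\xi\mathcal{G}$, and $\mathrm{adh}_\xi A=\mathrm{adh}_\xi\{A\}^{\uparrow}$ for $A\subset X$. $\lim_{\mathrm{Adh}_{\mathbb{M}}\xi}\mathcal{F}=\bigcap\{\mathrm{adh}_\xi\mathcal{D}:\mathcal{D}\in\mathbb{M}(X),\ \mathcal{D}\#\mathcal{F}\}$ and $\lim_{\mathrm{Base}_{\mathbb{D}}\xi}\mathcal{F}=\bigcup\{\lim_\xi\mathcal{D}:\mathcal{D}\in\mathbb{D}(X),\ \mathcal{D}\leq\mathcal{F}\}$. $(X,\xi)$ is $(\mathbb{J}/\mathbb{D})$-accessible if $\mathrm{adh}_\xi\mathcal{J}\subset\mathrm{adh}_{\mathrm{Base}_{\mathbb{D}}\xi}\mathcal{J}$ for every $\mathcal{J}\in\mathbb{J}(X)$ (adherence for $\mathrm{Base}_{\mathbb{D}}\xi$ defined by the same formula). The vicinity filter $\mathcal{V}_\xi(x)$ is the intersection of all filters converging to $x$; $\mathcal{V}_\xi(\mathcal{F})=\bigcup_{F\in\mathcal{F}}\bigcap_{x\in F}\mathcal{V}_\xi(x)$; $\xi$ is $P$-diagonal if $\lim_\xi\mathcal{F}\subset\lim_\xi\mathcal{V}_\xi(\mathcal{F})$ for every filter $\mathcal{F}$. $\mathrm{adh}_\xi^{\natural}(\mathbb{M})\subset\mathbb{M}$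 means: for every $\mathcal{M}\in\mathbb{M}(X)$ the filter generated by $\{\mathrm{adh}_\xi M:M\in\mathcal{M}\}$ belongs to $\mathbb{M}(X)$. Compactness. A filter $\mathcal{F}$ is $\mathbb{M}$-compact at $A\subset X$ (for $\xi$) if $\mathcal{M}\in\mathbb{M}(X)$, $\mathcal{M}\#\mathcal{F}$ imply $\mathrm{adh}_\xi\mathcal{M}\cap A\neq\emptyset$; a set $K$ is $\mathbb{M}$-compact if $\{K\}^{\uparrow}$ is $\mathbb{M}$-compact at $K$. $\mathcal{F}$ is $\mathbb{M}$-compactly $(\mathbb{J}/\mathbb{D})$-meshable at $A$ (for $\xi$) if for every $\mathcal{J}\in\mathbb{J}(X)$ with $\mathcal{J}\#\mathcal{F}$ there is $\mathcal{D}\in\mathbb{D}(X)$ with $\mathcal{D}\#\mathcal{J}$ and $\mathcal{D}$ $\mathbb{M}$-compact at $A$. A relation $R:(Y,\tau)\rightrightarrows(X,\xi)$ is $\mathbb{M}$-compactly $(\mathbb{J}/\mathbb{D})$-meshable if whenever $y\in\lim_\tau\mathcal{G}$, the filter $R\mathcal{G}$ generated by $\{RG:G\in\mathcal{G}\}$ is $\mathbb{M}$-compactly $(\mathbb{J}/\mathbb{D})$-meshable at $Ry$ for $\xi$. The inverse relation of $f$ is given by $f^{-}(y)=\{x\in X:f(x)=y\}$. A map $f:(X,\xi)\to(Y,\tau)$ is adherent if for all $H\subset X$ and $y\in Y$: $y\in\mathrm{adh}_\tau f(H)$ implies $\mathrm{adh}_\xi H\cap f^{-}(y)\neq\emptyset$.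 A surjection is $\mathbb{M}$-perfect if it is adherent and all its fibers $f^{-}(y)$ are $\mathbb{M}$-compact.
   Formalization: The formal theorem additionally assumes that the class M is F_1-composable and contains all principal filters; without these the equivalence fails (e.g. M only degenerate filters, the identity from discrete to chaotic {0,1}). *)

theory Defs
  imports Main
begin

text \<open>
  A filter on a carrier \<open>X\<close> is a library filter \<open>F \<le> principal X\<close>; it is determined by its trace
  on \<open>X\<close>, and the degenerate filter \<open>2\<^sup>X\<close> is \<open>bot\<close>.  The library order is the reverse of inclusion
  of families of sets: the family of \<open>F\<close> is contained in that of \<open>G\<close> iff \<open>G \<le> F\<close>.  Hence
  intersections of families are suprema, and the filter generated by a family of sets is the
  infimum of the corresponding principal filters.

  All sets are subsets of one arbitrary type \<open>'u\<close>, which serves as the universe over which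
  classes of filters, that is, assignments to each set of a collection of filters on it, range.
\<close>

type_synonym 'u filter_class = "'u set \<Rightarrow> 'u filter set"

type_synonym 'u convergence = "'u filter \<Rightarrow> 'u set"

definition sets_of :: "'u filter \<Rightarrow> 'u set set"
  where "sets_of F = {A. eventually (\<lambda>x. x \<in> A) F}"

definition proper_on :: "'u set \<Rightarrow> 'u filter \<Rightarrow> bool"
  where "proper_on X F \<longleftrightarrow> F \<le> principal X \<and> F \<noteq> bot"

definition mesh :: "'u filter \<Rightarrow> 'u filter \<Rightarrow> bool"
  where "mesh F G \<longleftrightarrow> (\<forall>A\<in>sets_of F. \<forall>B\<in>sets_of G. A \<inter> B \<noteq> {})"

definition generated :: "('u set \<Rightarrow> 'u set) \<Rightarrow> 'u filter \<Rightarrow> 'u filter"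
  where "generated g F = (INF A\<in>sets_of F. principal (g A))"

definition rel_filter_image :: "('u \<times> 'u) set \<Rightarrow> 'u filter \<Rightarrow> 'u filter"
  where "rel_filter_image H F = generated (\<lambda>A. H `` A) F"

definition class_of_filters :: "'u filter_class \<Rightarrow> bool"
  where "class_of_filters M \<longleftrightarrow> (\<forall>X. bot \<in> M X \<and> (\<forall>F\<in>M X. F \<le> principal X))"

definition F1 :: "'u filter_class"
  where "F1 X = {principal A |A. A \<subseteq> X}"

definition F1_composable :: "'u filter_class \<Rightarrow> bool"
  where "F1_composable D \<longleftrightarrow>
    (\<forall>X Y. \<forall>F\<in>D X. \<forall>H. H \<subseteq> X \<times> Y \<longrightarrow> rel_filter_image H F \<in> D Y)"

text \<open>
  Only proper filters on the carrier may converge; all other arguments are sent to \<open>{}\<close>, so that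
  two convergences on \<open>X\<close> are the same iff they are equal as functions.
\<close>

definition convergence_on :: "'u set \<Rightarrow> 'u convergence \<Rightarrow> bool"
  where "convergence_on X \<xi> \<longleftrightarrow>
    (\<forall>F. \<xi> F \<subseteq> X) \<and>
    (\<forall>F. \<not> proper_on X F \<longrightarrow> \<xi> F = {}) \<and>
    (\<forall>F G. proper_on X F \<and> proper_on X G \<and> G \<le> F \<longrightarrow> \<xi> F \<subseteq> \<xi> G) \<and>
    (\<forall>x\<in>X. x \<in> \<xi> (principal {x})) \<and>
    (\<forall>F G. proper_on X F \<and> proper_on X G \<longrightarrow> \<xi> (sup F G) = \<xi> F \<inter> \<xi> G)"

definition continuous_map_on ::
    "'u set \<Rightarrow> 'u convergence \<Rightarrow> 'u set \<Rightarrow> 'u convergence \<Rightarrow> ('u \<Rightarrow> 'u) \<Rightarrow> bool"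
  where "continuous_map_on X \<xi> Y \<tau> f \<longleftrightarrow>
    f ` X \<subseteq> Y \<and> (\<forall>F. proper_on X F \<longrightarrow> f ` \<xi> F \<subseteq> \<tau> (filtermap f F))"

definition adh :: "'u convergence \<Rightarrow> 'u filter \<Rightarrow> 'u set"
  where "adh \<xi> F = (\<Union>G\<in>{G. mesh G F}. \<xi> G)"

definition adh_set :: "'u convergence \<Rightarrow> 'u set \<Rightarrow> 'u set"
  where "adh_set \<xi> A = adh \<xi> (principal A)"

text \<open>An empty intersection is the whole carrier.\<close>

definition Adh :: "'u filter_class \<Rightarrow> 'u set \<Rightarrow> 'u convergence \<Rightarrow> 'u convergence"
  where "Adh M X \<xi> F =
    (if proper_on X F then {x\<in>X. \<forall>D\<in>M X. mesh D F \<longrightarrow> x \<in> adh \<xi> D} else {})"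

definition Base :: "'u filter_class \<Rightarrow> 'u set \<Rightarrow> 'u convergence \<Rightarrow> 'u convergence"
  where "Base D X \<xi> F = (if proper_on X F then (\<Union>E\<in>{E\<in>D X. F \<le> E}. \<xi> E) else {})"

definition accessible ::
    "'u filter_class \<Rightarrow> 'u filter_class \<Rightarrow> 'u set \<Rightarrow> 'u convergence \<Rightarrow> bool"
  where "accessible J D X \<xi> \<longleftrightarrow> (\<forall>F\<in>J X. adh \<xi> F \<subseteq> adh (Base D X \<xi>) F)"

definition vicinity :: "'u convergence \<Rightarrow> 'u \<Rightarrow> 'u filter"
  where "vicinity \<xi> x = Sup {F. x \<in> \<xi> F}"

text \<open>
  The infimum below is over a downward directed family, so on the level of families of sets it
  is the union; see \<open>sets_of_vicinity_filter\<close>.  Points outside the carrier have vicinity filter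
  \<open>bot\<close>, so intersecting the members of \<open>F\<close> with the carrier changes nothing.
\<close>

definition vicinity_filter :: "'u convergence \<Rightarrow> 'u filter \<Rightarrow> 'u filter"
  where "vicinity_filter \<xi> F = (INF A\<in>sets_of F. SUP x\<in>A. vicinity \<xi> x)"

lemma sets_of_vicinity_filter:
  "sets_of (vicinity_filter \<xi> F) = (\<Union>A\<in>sets_of F. \<Inter>x\<in>A. sets_of (vicinity \<xi> x))"
proof -
  have "eventually P (vicinity_filter \<xi> F) \<longleftrightarrow>
      (\<exists>A\<in>sets_of F. eventually P (SUP x\<in>A. vicinity \<xi> x))" for P
    unfolding vicinity_filter_def
  proof (rule eventually_INF_base)
    show "sets_of F \<noteq> {}"
      by (auto simp: sets_of_def intro!: exI[of _ UNIV])
    fix A B assume "A \<in> sets_of F" "B \<in> sets_of F"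
    then show "\<exists>C\<in>sets_of F. (SUP x\<in>C. vicinity \<xi> x) \<le>
        inf (SUP x\<in>A. vicinity \<xi> x) (SUP x\<in>B. vicinity \<xi> x)"
      by (intro bexI[of _ "A \<inter> B"] le_infI SUP_subset_mono)
        (auto simp: sets_of_def eventually_conj)
  qed
  then show ?thesis
    by (auto simp: sets_of_def eventually_Sup)
qed

definition P_diagonal :: "'u set \<Rightarrow> 'u convergence \<Rightarrow> bool"
  where "P_diagonal X \<xi> \<longleftrightarrow> (\<forall>F. proper_on X F \<longrightarrow> \<xi> F \<subseteq> \<xi> (vicinity_filter \<xi> F))"

definition adh_natural_closed :: "'u filter_class \<Rightarrow> 'u set \<Rightarrow> 'u convergence \<Rightarrow> bool"
  where "adh_natural_closed M X \<xi> \<longleftrightarrow> (\<forall>F\<in>M X. generated (adh_set \<xi>) F \<in> M X)"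

definition compact_at ::
    "'u filter_class \<Rightarrow> 'u set \<Rightarrow> 'u convergence \<Rightarrow> 'u set \<Rightarrow> 'u filter \<Rightarrow> bool"
  where "compact_at M X \<xi> A F \<longleftrightarrow> (\<forall>E\<in>M X. mesh E F \<longrightarrow> adh \<xi> E \<inter> A \<noteq> {})"

definition compact_subset ::
    "'u filter_class \<Rightarrow> 'u set \<Rightarrow> 'u convergence \<Rightarrow> 'u set \<Rightarrow> bool"
  where "compact_subset M X \<xi> K \<longleftrightarrow> K \<subseteq> X \<and> compact_at M X \<xi> K (principal K)"

definition compactly_meshable_at ::
    "'u filter_class \<Rightarrow> 'u filter_class \<Rightarrow> 'u filter_class \<Rightarrow> 'u set \<Rightarrow> 'u convergence \<Rightarrow>
      'u set \<Rightarrow> 'u filter \<Rightarrow> bool"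
  where "compactly_meshable_at M J D X \<xi> A F \<longleftrightarrow>
    (\<forall>G\<in>J X. mesh G F \<longrightarrow> (\<exists>E\<in>D X. mesh E G \<and> compact_at M X \<xi> A E))"

definition compactly_meshable_relation ::
    "'u filter_class \<Rightarrow> 'u filter_class \<Rightarrow> 'u filter_class \<Rightarrow> 'u set \<Rightarrow> 'u convergence \<Rightarrow>
      'u set \<Rightarrow> 'u convergence \<Rightarrow> ('u \<times> 'u) set \<Rightarrow> bool"
  where "compactly_meshable_relation M J D Y \<tau> X \<xi> R \<longleftrightarrow>
    R \<subseteq> Y \<times> X \<and>
    (\<forall>y G. y \<in> \<tau> G \<longrightarrow>
      compactly_meshable_at M J D X \<xi> (R `` {y}) (rel_filter_image R G))"

definition inverse_relation :: "'u set \<Rightarrow> ('u \<Rightarrow> 'u) \<Rightarrow> ('u \<times> 'u) set"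
  where "inverse_relation X f = {(y, x). x \<in> X \<and> f x = y}"

definition adherent_map ::
    "'u set \<Rightarrow> 'u convergence \<Rightarrow> 'u set \<Rightarrow> 'u convergence \<Rightarrow> ('u \<Rightarrow> 'u) \<Rightarrow> bool"
  where "adherent_map X \<xi> Y \<tau> f \<longleftrightarrow>
    (\<forall>H y. H \<subseteq> X \<longrightarrow> y \<in> Y \<longrightarrow> y \<in> adh_set \<tau> (f ` H) \<longrightarrow>
      adh_set \<xi> H \<inter> inverse_relation X f `` {y} \<noteq> {})"

definition perfect_map ::
    "'u filter_class \<Rightarrow> 'u set \<Rightarrow> 'u convergence \<Rightarrow> 'u set \<Rightarrow> 'u convergence \<Rightarrow>
      ('u \<Rightarrow> 'u) \<Rightarrow> bool"
  where "perfect_map M X \<xi> Y \<tau> f \<longleftrightarrow>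
    f ` X = Y \<and> adherent_map X \<xi> Y \<tau> f \<and>
    (\<forall>y\<in>Y. compact_subset M X \<xi> (inverse_relation X f `` {y}))"

end

theory Submission
  imports Defs
begin

text \<open>
  The filter images under a relation and under its inverse are adjoint with respect to meshing.
  For sufficiency, this carries the compactly meshable condition back and forth along \<open>f\<close>, and
  \<open>\<tau> = Adh M \<tau>\<close> turns compactness at a fibre \<open>f\<^sup>- y\<close> into convergence to \<open>y\<close> of the image filter.
  For necessity, accessibility yields a filter \<open>E\<close> of the class \<open>D\<close> with limit \<open>y\<close>.  If \<open>N\<close> in \<open>M\<close>
  meshes with \<open>f\<^sup>- E\<close>, then, \<open>f\<close> being adherent, the adherence of each member of \<open>N\<close> meets the fibre.
  Compactness of the fibre therefore gives an adherent point of \<open>adh\<^sup>\<natural> N\<close> in it, and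
  \<open>P\<close>-diagonality makes this an adherent point of \<open>N\<close>.
\<close>

section \<open>Filters described by their families of sets\<close>

lemma sets_of_antimono: "F \<le> G \<Longrightarrow> sets_of G \<subseteq> sets_of F"
  by (auto simp: sets_of_def le_filter_def)

lemma sets_of_mono: "A \<in> sets_of F \<Longrightarrow> A \<subseteq> B \<Longrightarrow> B \<in> sets_of F"
  by (auto simp: sets_of_def elim: eventually_mono)

lemma sets_of_principal: "sets_of (principal A) = {B. A \<subseteq> B}"
  by (auto simp: sets_of_def eventually_principal)

lemma in_sets_of_iff: "A \<in> sets_of F \<longleftrightarrow> F \<le> principal A"
  by (simp add: sets_of_def le_principal)

lemma filter_eqI_sets_of: "sets_of F = sets_of G \<Longrightarrow> F = G"
  by (auto simp: sets_of_def filter_eq_iff set_eq_iff dest: spec[of _ "Collect _"])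

lemma sets_of_Int: "A \<in> sets_of F \<Longrightarrow> B \<in> sets_of F \<Longrightarrow> A \<inter> B \<in> sets_of F"
  by (simp add: sets_of_def eventually_conj)

text \<open>Monotonicity makes the sets \<open>g A\<close> downward directed, as
  \<open>g (A \<inter> B)\<close> lies in both \<open>g A\<close> and \<open>g B\<close>; so every
  set of the infimum already contains a single \<open>g A\<close>.\<close>

lemma sets_of_generated:
  assumes "mono g"
  shows "sets_of (generated g F) = (\<Union>A\<in>sets_of F. {B. g A \<subseteq> B})"
proof -
  have "eventually P (generated g F) \<longleftrightarrow> (\<exists>A\<in>sets_of F. eventually P (principal (g A)))" for P
    unfolding generated_def
  proof (rule eventually_INF_base)
    show "sets_of F \<noteq> {}"
      by (auto simp: sets_of_def intro!: exI[of _ UNIV])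
    fix A B assume "A \<in> sets_of F" "B \<in> sets_of F"
    then show "\<exists>C\<in>sets_of F. principal (g C) \<le> inf (principal (g A)) (principal (g B))"
      using monoD[OF assms, of "A \<inter> B" A] monoD[OF assms, of "A \<inter> B" B]
      by (intro bexI[of _ "A \<inter> B"]) (auto intro: sets_of_Int)
  qed
  then show ?thesis
    by (auto simp: sets_of_def eventually_principal)
qed

section \<open>Meshing and images of filters under relations\<close>

lemma mesh_commute: "mesh F G \<longleftrightarrow> mesh G F"
  by (auto simp: mesh_def Int_commute)

lemma mesh_mono: "mesh F G \<Longrightarrow> F \<le> F' \<Longrightarrow> G \<le> G' \<Longrightarrow> mesh F' G'"
  by (meson mesh_def sets_of_antimono subsetD)

lemma mesh_not_bot: "mesh F G \<Longrightarrow> F \<noteq> bot"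
proof
  assume "mesh F G" "F = bot"
  moreover have "{} \<in> sets_of bot" "UNIV \<in> sets_of G"
    by (simp_all add: sets_of_def)
  ultimately show False
    unfolding mesh_def by blast
qed

lemma mesh_generated_iff:
  assumes "mono g"
  shows "mesh (generated g F) G \<longleftrightarrow> (\<forall>A\<in>sets_of F. \<forall>B\<in>sets_of G. g A \<inter> B \<noteq> {})"
  unfolding mesh_def sets_of_generated[OF assms] by blast

lemma mono_Image: "mono (\<lambda>A. H `` A)"
  by (auto simp: mono_def)

text \<open>A pair of \<open>H\<close> leading from a member of \<open>F\<close> to a member of
  \<open>G\<close> witnesses both sides, so an image moves across the mesh at the price of a
  converse.\<close>

lemma mesh_rel_filter_image_iff:
  "mesh (rel_filter_image H F) G \<longleftrightarrow> mesh F (rel_filter_image (H\<inverse>) G)"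
proof -
  have "H `` A \<inter> B \<noteq> {} \<longleftrightarrow> H\<inverse> `` B \<inter> A \<noteq> {}" for A B
    by blast
  then show ?thesis
    by (subst mesh_commute[of F])
      (auto simp: rel_filter_image_def mesh_generated_iff[OF mono_Image])
qed

lemma mesh_rel_filter_image_iff':
  "mesh F (rel_filter_image H G) \<longleftrightarrow> mesh (rel_filter_image (H\<inverse>) F) G"
  using mesh_rel_filter_image_iff[of H G F] mesh_commute by metis

lemma rel_filter_image_principal: "rel_filter_image H (principal A) = principal (H `` A)"
  by (rule filter_eqI_sets_of)
    (auto simp: rel_filter_image_def sets_of_generated[OF mono_Image] sets_of_principal)

lemma inverse_relation_subset: "f ` X \<subseteq> Y \<Longrightarrow> inverse_relation X f \<subseteq> Y \<times> X"
  by (auto simp: inverse_relation_def)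

lemma converse_inverse_relation_Image: "(inverse_relation X f)\<inverse> `` A = f ` (A \<inter> X)"
  by (auto simp: inverse_relation_def)

text \<open>The relation sees only points of \<open>X\<close>, which is harmless because
  \<open>X\<close> belongs to \<open>F\<close>. Through this identity \<open>F1_composable\<close>
  and the adjunction apply to images under \<open>f\<close>.\<close>

lemma rel_filter_image_converse_inverse_relation:
  assumes "F \<le> principal X"
  shows "rel_filter_image ((inverse_relation X f)\<inverse>) F = filtermap f F"
proof (rule filter_eqI_sets_of)
  have X: "X \<in> sets_of F"
    using assms by (simp add: in_sets_of_iff)
  have "(\<exists>A\<in>sets_of F. f ` (A \<inter> X) \<subseteq> B) \<longleftrightarrow> f -` B \<in> sets_of F" for B
  proof
    assume "\<exists>A\<in>sets_of F. f ` (A \<inter> X) \<subseteq> B"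
    then obtain A where A: "A \<in> sets_of F" "f ` (A \<inter> X) \<subseteq> B" by blast
    have "A \<inter> X \<in> sets_of F"
      using A(1) X by (rule sets_of_Int)
    then show "f -` B \<in> sets_of F"
      by (rule sets_of_mono) (use A(2) in blast)
  next
    assume "f -` B \<in> sets_of F"
    then show "\<exists>A\<in>sets_of F. f ` (A \<inter> X) \<subseteq> B"
      by (rule bexI[rotated]) blast
  qed
  then show "sets_of (rel_filter_image ((inverse_relation X f)\<inverse>) F) = sets_of (filtermap f F)"
    unfolding rel_filter_image_def sets_of_generated[OF mono_Image]
      converse_inverse_relation_Image
    by (auto simp: sets_of_def eventually_filtermap)
qed

text \<open>Members of \<open>F\<close> and \<open>G\<close> share a point of \<open>Y\<close>, and
  any \<open>H\<close>-successor of it lies in both images.\<close>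

lemma mesh_rel_filter_image_total:
  assumes "mesh F G" "F \<le> principal Y" "Y \<subseteq> Domain H"
  shows "mesh (rel_filter_image H F) (rel_filter_image H G)"
proof -
  have "H `` A \<inter> H `` B \<noteq> {}" if A: "A \<in> sets_of F" and B: "B \<in> sets_of G" for A B
  proof -
    have "A \<inter> Y \<in> sets_of F"
      using A assms(2) by (simp add: in_sets_of_iff flip: inf_principal)
    then obtain y where "y \<in> A" "y \<in> B" "y \<in> Y"
      using assms(1) B by (fastforce simp: mesh_def)
    then show ?thesis
      using assms(3) by blast
  qed
  then show ?thesis
    unfolding rel_filter_image_def mesh_generated_iff[OF mono_Image]
      sets_of_generated[OF mono_Image] by blast
qed

section \<open>Adherence and P-diagonality\<close>

lemma convergence_on_limD:
  assumes "convergence_on X \<xi>" "x \<in> \<xi> F"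
  shows "x \<in> X" "proper_on X F"
  using assms by (auto simp: convergence_on_def)

lemma adhI: "x \<in> \<xi> G \<Longrightarrow> mesh G F \<Longrightarrow> x \<in> adh \<xi> F"
  by (auto simp: adh_def)

lemma adhE:
  assumes "x \<in> adh \<xi> F"
  obtains G where "x \<in> \<xi> G" "mesh G F"
  using assms by (auto simp: adh_def)

lemma mono_adh_set: "mono (adh_set \<xi>)"
  unfolding mono_def adh_set_def by (auto elim!: adhE intro!: adhI elim: mesh_mono)

text \<open>A member \<open>A\<close> of the vicinity filter is a vicinity of every point of some
  \<open>B\<close> in \<open>G\<close>, and \<open>B\<close> meets the adherence of each member
  \<open>N\<close> of \<open>F\<close>. A common point is a limit of some filter meshing with
  \<open>N\<close>, and that filter contains \<open>A\<close>.\<close>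

lemma vicinity_filter_mesh:
  assumes "mesh G (generated (adh_set \<xi>) F)"
  shows "mesh (vicinity_filter \<xi> G) F"
  unfolding mesh_def
proof (intro ballI)
  fix A N assume A: "A \<in> sets_of (vicinity_filter \<xi> G)" and N: "N \<in> sets_of F"
  obtain B where B: "B \<in> sets_of G" "\<And>b. b \<in> B \<Longrightarrow> A \<in> sets_of (vicinity \<xi> b)"
    using A by (auto simp: sets_of_vicinity_filter)
  have "adh_set \<xi> N \<inter> B \<noteq> {}"
    using assms N B(1) by (simp add: mesh_commute[of G] mesh_generated_iff[OF mono_adh_set])
  then obtain b H where b: "b \<in> B" "b \<in> \<xi> H" "mesh H (principal N)"
    by (auto simp: adh_set_def elim!: adhE)
  have "A \<in> sets_of H"
    using B(2)[OF b(1)] b(2) by (auto simp: vicinity_def sets_of_def eventually_Sup)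
  with b(3) show "A \<inter> N \<noteq> {}"
    by (auto simp: mesh_def sets_of_principal)
qed

text \<open>A limit of \<open>G\<close> is also a limit of its vicinity filter, which meshes with
  \<open>F\<close> itself as soon as \<open>G\<close> meshes with the adherences of its
  members.\<close>

lemma P_diagonal_adh_generated_adh_set:
  assumes "convergence_on X \<xi>" "P_diagonal X \<xi>"
  shows "adh \<xi> (generated (adh_set \<xi>) F) \<subseteq> adh \<xi> F"
proof
  fix x assume "x \<in> adh \<xi> (generated (adh_set \<xi>) F)"
  then obtain G where G: "x \<in> \<xi> G" "mesh G (generated (adh_set \<xi>) F)"
    by (rule adhE)
  then have "x \<in> \<xi> (vicinity_filter \<xi> G)"
    using assms convergence_on_limD(2)[OF assms(1) G(1)] by (auto simp: P_diagonal_def)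
  then show "x \<in> adh \<xi> F"
    using vicinity_filter_mesh[OF G(2)] by (rule adhI)
qed

text \<open>Upgrades compactness of the fibre as a set to compactness at the fibre of the filter
  pulled back from \<open>E\<close>; this filter is the witness needed for necessity.\<close>

lemma perfect_map_rel_filter_image_compact_at:
  assumes "class_of_filters M" "convergence_on Y \<tau>" "convergence_on X \<xi>"
    and "P_diagonal X \<xi>" "adh_natural_closed M X \<xi>"
    and perfect: "perfect_map M X \<xi> Y \<tau> f"
    and y: "y \<in> \<tau> E"
  shows "compact_at M X \<xi> (inverse_relation X f `` {y})
    (rel_filter_image (inverse_relation X f) E)"
  unfolding compact_at_def
proof (intro ballI impI)
  let ?R = "inverse_relation X f"
  fix N assume N: "N \<in> M X" and NE: "mesh N (rel_filter_image ?R E)"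
  have yY: "y \<in> Y"
    using convergence_on_limD(1)[OF assms(2) y] .
  have "adh_set \<xi> A \<inter> ?R `` {y} \<noteq> {}" if A: "A \<in> sets_of N" for A
  proof -
    have "mesh (rel_filter_image ?R E) (principal A)"
      using NE A by (meson in_sets_of_iff mesh_commute mesh_mono order_refl)
    then have "mesh E (principal (f ` (A \<inter> X)))"
      by (simp add: mesh_rel_filter_image_iff rel_filter_image_principal
          converse_inverse_relation_Image)
    then have "y \<in> adh_set \<tau> (f ` (A \<inter> X))"
      unfolding adh_set_def using y by (intro adhI)
    \<comment> \<open>\<open>adherent_map\<close> speaks of subsets of \<open>X\<close>, so it is
      applied to the trace of \<open>A\<close>; monotonicity of \<open>adh_set\<close> then returns
      to \<open>A\<close>.\<close>
    then have "adh_set \<xi> (A \<inter> X) \<inter> ?R `` {y} \<noteq> {}"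
      using perfect yY by (auto simp: perfect_map_def adherent_map_def)
    then show ?thesis
      using monoD[OF mono_adh_set, of "A \<inter> X" A \<xi>] by blast
  qed
  then have "mesh (generated (adh_set \<xi>) N) (principal (?R `` {y}))"
    unfolding mesh_generated_iff[OF mono_adh_set] sets_of_principal by blast
  moreover have "generated (adh_set \<xi>) N \<in> M X"
    using assms(5) N by (auto simp: adh_natural_closed_def)
  ultimately have "adh \<xi> (generated (adh_set \<xi>) N) \<inter> ?R `` {y} \<noteq> {}"
    using perfect yY by (auto simp: perfect_map_def compact_subset_def compact_at_def)
  then show "adh \<xi> N \<inter> ?R `` {y} \<noteq> {}"
    using P_diagonal_adh_generated_adh_set[OF assms(3,4), of N] by blast
qed

text \<open>By \<open>\<tau> = Adh M Y \<tau>\<close>, convergence is tested on filters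
  \<open>N\<close> in \<open>M\<close>. Composability pulls \<open>N\<close> back to
  \<open>X\<close>, compactness finds an adherent point in the fibre, and continuity pushes a filter
  witnessing it forward to \<open>Y\<close>.\<close>

lemma compact_at_fibre_imp_lim:
  assumes "F1_composable M" "convergence_on Y \<tau>" "\<tau> = Adh M Y \<tau>"
    and "convergence_on X \<xi>" "continuous_map_on X \<xi> Y \<tau> f"
    and E: "proper_on X E" and y: "y \<in> Y"
    and compact: "compact_at M X \<xi> (inverse_relation X f `` {y}) E"
  shows "y \<in> \<tau> (filtermap f E)"
proof -
  let ?R = "inverse_relation X f"
  have fX: "f ` X \<subseteq> Y"
    using assms(5) by (simp add: continuous_map_on_def)
  have fE: "filtermap f E = rel_filter_image (?R\<inverse>) E"
    using E by (simp add: proper_on_def rel_filter_image_converse_inverse_relation)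
  have "y \<in> adh \<tau> N" if N: "N \<in> M Y" "mesh N (filtermap f E)" for N
  proof -
    have "rel_filter_image ?R N \<in> M X"
      using assms(1) N(1) inverse_relation_subset[OF fX] by (auto simp: F1_composable_def)
    moreover have "mesh (rel_filter_image ?R N) E"
      using N(2) by (simp add: fE mesh_rel_filter_image_iff)
    ultimately have "adh \<xi> (rel_filter_image ?R N) \<inter> ?R `` {y} \<noteq> {}"
      using compact by (auto simp: compact_at_def)
    then obtain x where "x \<in> adh \<xi> (rel_filter_image ?R N)" and x: "f x = y"
      by (auto simp: inverse_relation_def)
    then obtain G where G: "x \<in> \<xi> G" "mesh G (rel_filter_image ?R N)"
      by (auto elim: adhE)
    have properG: "proper_on X G"
      using convergence_on_limD(2)[OF assms(4) G(1)] .
    have "y \<in> \<tau> (filtermap f G)"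
      using assms(5) properG G(1) unfolding x[symmetric] continuous_map_on_def by blast
    moreover have "mesh (filtermap f G) N"
      using G(2) properG
      by (simp add: mesh_rel_filter_image_iff' rel_filter_image_converse_inverse_relation
          proper_on_def)
    ultimately show ?thesis
      by (rule adhI)
  qed
  moreover have "filtermap f E \<le> principal Y"
    using E fX unfolding proper_on_def le_principal eventually_filtermap
    by (auto elim!: eventually_mono)
  then have "proper_on Y (filtermap f E)"
    using E by (simp add: proper_on_def filtermap_bot_iff)
  ultimately have "y \<in> Adh M Y \<tau> (filtermap f E)"
    using y by (simp add: Adh_def)
  then show ?thesis
    by (subst assms(3))
qed

theorem theorem17:
  fixes M J D :: "'u filter_class"
    and X Y :: "'u set"
    and \<xi> \<tau> :: "'u convergence"
    and f :: "'u \<Rightarrow> 'u"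
  assumes "class_of_filters M" and "class_of_filters J" and "class_of_filters D"
    and "\<forall>Z. M Z \<subseteq> J Z"
    and "F1_composable J" and "F1_composable D"
    and "F1_composable M" and "\<forall>Z. F1 Z \<subseteq> M Z"
    and "convergence_on Y \<tau>" and "\<tau> = Adh M Y \<tau>"
    and "convergence_on X \<xi>" and "P_diagonal X \<xi>" and "adh_natural_closed M X \<xi>"
    and "continuous_map_on X \<xi> Y \<tau> f" and "f ` X = Y"
  shows "perfect_map M X \<xi> Y \<tau> f \<and> accessible J D Y \<tau> \<longleftrightarrow>
    compactly_meshable_relation M J D Y \<tau> X \<xi> (inverse_relation X f)"
proof
  let ?R = "inverse_relation X f"
  have fX: "f ` X \<subseteq> Y"
    using assms(15) by simp
  have RYX: "?R \<subseteq> Y \<times> X" "?R\<inverse> \<subseteq> X \<times> Y"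
    using inverse_relation_subset[OF fX] by auto
  {
    assume L: "perfect_map M X \<xi> Y \<tau> f \<and> accessible J D Y \<tau>"
    show "compactly_meshable_relation M J D Y \<tau> X \<xi> ?R"
      unfolding compactly_meshable_relation_def compactly_meshable_at_def
    proof (intro conjI allI impI ballI)
      fix y G F
      assume y: "y \<in> \<tau> G" and F: "F \<in> J X" and FG: "mesh F (rel_filter_image ?R G)"
      have "mesh G (rel_filter_image (?R\<inverse>) F)"
        using FG mesh_commute by (metis mesh_rel_filter_image_iff')
      with y have "y \<in> adh \<tau> (rel_filter_image (?R\<inverse>) F)"
        by (rule adhI)
      moreover have "rel_filter_image (?R\<inverse>) F \<in> J Y"
        using assms(5) F RYX(2) by (auto simp: F1_composable_def)
      ultimately have "y \<in> adh (Base D Y \<tau>) (rel_filter_image (?R\<inverse>) F)"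
        using L by (auto simp: accessible_def)
      then obtain G' where G': "y \<in> Base D Y \<tau> G'" "mesh G' (rel_filter_image (?R\<inverse>) F)"
        by (rule adhE)
      \<comment> \<open>\<open>G' \<le> E\<close> says that \<open>E\<close> is coarser, so
        \<open>E\<close> inherits the mesh of \<open>G'\<close> with the image of
        \<open>F\<close>.\<close>
      then obtain E where E: "E \<in> D Y" "G' \<le> E" "y \<in> \<tau> E"
        by (auto simp: Base_def split: if_splits)
      show "\<exists>E\<in>D X. mesh E F \<and> compact_at M X \<xi> (?R `` {y}) E"
      proof (intro bexI conjI)
        show "rel_filter_image ?R E \<in> D X"
          using assms(6) E(1) RYX(1) by (auto simp: F1_composable_def)
        show "mesh (rel_filter_image ?R E) F"
          using mesh_mono[OF G'(2) E(2) order_refl] by (simp add: mesh_rel_filter_image_iff)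
        show "compact_at M X \<xi> (?R `` {y}) (rel_filter_image ?R E)"
          using perfect_map_rel_filter_image_compact_at[OF assms(1,9,11-13) _ E(3)] L by blast
      qed
    qed (use RYX in auto)
  next
    assume "compactly_meshable_relation M J D Y \<tau> X \<xi> ?R"
    then have meshable: "\<exists>E\<in>D X. mesh E F \<and> compact_at M X \<xi> (?R `` {y}) E"
      if "y \<in> \<tau> G" "F \<in> J X" "mesh F (rel_filter_image ?R G)" for y G F
      using that unfolding compactly_meshable_relation_def compactly_meshable_at_def by blast
    \<comment> \<open>As \<open>M\<close> is contained in \<open>J\<close>, \<open>N\<close> plays
      two parts: it is the filter for which meshability supplies \<open>E\<close>, and then the
      filter on which compactness of \<open>E\<close> is tested.\<close>
    have adh_meets_fibre: "adh \<xi> N \<inter> ?R `` {y} \<noteq> {}"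
      if y: "y \<in> \<tau> G" and N: "N \<in> M X" "mesh N (rel_filter_image ?R G)" for y G N
    proof -
      obtain E where "mesh E N" "compact_at M X \<xi> (?R `` {y}) E"
        using meshable[OF y _ N(2)] N(1) assms(4) by blast
      then show ?thesis
        using N(1) mesh_commute[of E N] by (simp add: compact_at_def)
    qed
    have "adherent_map X \<xi> Y \<tau> f"
      unfolding adherent_map_def
    proof (intro allI impI)
      fix H y assume H: "H \<subseteq> X" and "y \<in> adh_set \<tau> (f ` H)"
      then obtain G where G: "y \<in> \<tau> G" "mesh G (principal (f ` H))"
        by (auto simp: adh_set_def elim: adhE)
      \<comment> \<open>Adherence of the map is the case of a principal \<open>N\<close>.\<close>
      have "mesh (rel_filter_image ?R G) (principal H)"
        using G(2) H by (simp add: mesh_rel_filter_image_iff rel_filter_image_principal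
            converse_inverse_relation_Image Int_absorb2)
      moreover have "principal H \<in> M X"
        using assms(8) H by (auto simp: F1_def)
      ultimately show "adh_set \<xi> H \<inter> ?R `` {y} \<noteq> {}"
        using adh_meets_fibre[OF G(1)] mesh_commute unfolding adh_set_def by blast
    qed
    moreover have "compact_subset M X \<xi> (?R `` {y})" if "y \<in> Y" for y
      unfolding compact_subset_def compact_at_def
    proof (intro conjI ballI impI)
      \<comment> \<open>Compactness of the fibre is the case of the point filter, whose image under
        \<open>?R\<close> is principal on the fibre.\<close>
      have "y \<in> \<tau> (principal {y})"
        using assms(9) that by (auto simp: convergence_on_def)
      then show "adh \<xi> N \<inter> ?R `` {y} \<noteq> {}"
        if "N \<in> M X" "mesh N (principal (?R `` {y}))" for N
        using that adh_meets_fibre by (simp add: rel_filter_image_principal)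
    qed (use RYX in auto)
    moreover have "accessible J D Y \<tau>"
      unfolding accessible_def
    proof (intro ballI subsetI)
      fix F y assume F: "F \<in> J Y" and "y \<in> adh \<tau> F"
      then obtain G where G: "y \<in> \<tau> G" "mesh G F"
        by (auto elim: adhE)
      have y: "y \<in> Y"
        using convergence_on_limD(1)[OF assms(9) G(1)] .
      have "F \<le> principal Y"
        using assms(2) F by (auto simp: class_of_filters_def)
      \<comment> \<open>Surjectivity of \<open>f\<close> makes \<open>?R\<close> total on
        \<open>Y\<close>.\<close>
      then have "mesh (rel_filter_image ?R F) (rel_filter_image ?R G)"
        using G(2) assms(15) mesh_commute
        by (intro mesh_rel_filter_image_total[where Y = Y]) (auto simp: inverse_relation_def)
      moreover have "rel_filter_image ?R F \<in> J X"
        using assms(5) F RYX(1) by (auto simp: F1_composable_def)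
      ultimately obtain E where E: "E \<in> D X" "mesh E (rel_filter_image ?R F)"
        and compact: "compact_at M X \<xi> (?R `` {y}) E"
        using meshable[OF G(1)] by blast
      \<comment> \<open>Classes contain \<open>bot\<close>, so non-degeneracy has to come from the
        mesh.\<close>
      have properE: "proper_on X E"
        using assms(3) E mesh_not_bot by (auto simp: class_of_filters_def proper_on_def)
      have fE: "filtermap f E = rel_filter_image (?R\<inverse>) E"
        using properE by (simp add: proper_on_def rel_filter_image_converse_inverse_relation)
      have lim: "y \<in> \<tau> (filtermap f E)"
        by (rule compact_at_fibre_imp_lim[OF assms(7,9,10,11,14) properE y compact])
      have "filtermap f E \<in> D Y"
        unfolding fE using assms(6) E(1) RYX(2) by (auto simp: F1_composable_def)
      \<comment> \<open>Being in \<open>D Y\<close>, the image filter serves as its own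
        base.\<close>
      then have "y \<in> Base D Y \<tau> (filtermap f E)"
        using lim convergence_on_limD(2)[OF assms(9) lim] by (auto simp: Base_def)
      moreover have "mesh (filtermap f E) F"
        using E(2) by (simp add: fE mesh_rel_filter_image_iff')
      ultimately show "y \<in> adh (Base D Y \<tau>) F"
        by (rule adhI)
    qed
    ultimately show "perfect_map M X \<xi> Y \<tau> f \<and> accessible J D Y \<tau>"
      using assms(15) by (simp add: perfect_map_def)
  }
qed

end
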